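(* Let $r\ge 1$ be an integer, let $q=2^r$, and let $1\le s\le r$ be an integer such that $\gcd(s,r)=1$. Let $G(2^r,s)$ denote the bipartite graph whose parts $A$ and $B$ are two disjoint copies of $\mathbb F_q^3$, where $(a_1,a_2,a_3)\in A$ is adjacent to $(b_1,b_2,b_3)\in B$ if and only if $$b_2+a_2=a_1b_1\quad\text{and}\quad b_3+a_3=a_1b_1^{2^s}.$$ Then $G(2^r,s)$ is $C_6$-free.
   Context: $\mathbb F_q$ is the finite field with $q$ elements. A graph is $C_6$-free if it contains no cycle of length $6$ as a (not necessarily induced) subgraph. *)

theory Defs
  imports "Graph_Theory.Pair_Digraph" "HOL-Library.Cardinality"
begin

text \<open>
  As in the Graph-Theory library, a simple graph is a symmetric loop-free finite digraph
  (locale \<^locale>\<open>pair_graph\<close>): an edge is represented by its two opposite arcs.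
  The library's cycles have pairwise distinct vertices, and may have length 2
  (traversing an edge back and forth). For length 6 they are exactly the
  6-cycles of the undirected graph.
\<close>

definition C6_free :: "'v pair_pre_digraph \<Rightarrow> bool" where
  "C6_free G \<longleftrightarrow> \<not> (\<exists>p. pre_digraph.cycle (with_proj G) p \<and> length p = 6)"

fun adj_G :: "nat \<Rightarrow> 'a::field \<times> 'a \<times> 'a \<Rightarrow> 'a \<times> 'a \<times> 'a \<Rightarrow> bool" where
  "adj_G s (a1, a2, a3) (b1, b2, b3) \<longleftrightarrow>
     b2 + a2 = a1 * b1 \<and> b3 + a3 = a1 * b1 ^ (2 ^ s)"

text \<open>
  The graph $G(2^r,s)$ when \<open>'a\<close> is the field with $2^r$ elements. The parts
  $A$ and $B$ are \<open>range Inl\<close> and \<open>range Inr\<close>.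
\<close>

definition graph_G ::
  "nat \<Rightarrow> (('a::{field,finite} \<times> 'a \<times> 'a) + ('a \<times> 'a \<times> 'a)) pair_pre_digraph" where
  "graph_G s = \<lparr> pverts = UNIV,
     parcs = {(Inl a, Inr b) | a b. adj_G s a b} \<union> {(Inr b, Inl a) | a b. adj_G s a b} \<rparr>"

lemma pair_graph_graph_G: "pair_graph (graph_G s)"
  by unfold_locales
    (auto simp: graph_G_def symmetric_def arcs_ends_def arc_to_ends_def with_proj_def
      image_iff intro!: symI)

lemma graph_G_arc_iff:
  "(Inl a, Inr b) \<in> parcs (graph_G s) \<longleftrightarrow> adj_G s a b"
  "(Inr b, Inl a) \<in> parcs (graph_G s) \<longleftrightarrow> adj_G s a b"
  "(Inl a, Inl a') \<notin> parcs (graph_G s)"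
  "(Inr b, Inr b') \<notin> parcs (graph_G s)"
  by (cases a; cases b; auto simp: graph_G_def)+

end

theory Submission
  imports Defs "HOL-Computational_Algebra.Primes"
begin

text \<open>
  A \<open>6\<close>-cycle \<open>a\<^sub>1 b\<^sub>1 a\<^sub>2 b\<^sub>2 a\<^sub>3 b\<^sub>3\<close> yields six instances of each of the two
  adjacency equations. In their alternating sum the second (respectively third) coordinates
  cancel (\<open>hexagon_alternating_sum\<close>). Writing \<open>p\<^sub>i\<close> and \<open>x\<^sub>i\<close> for the first coordinates of \<open>a\<^sub>i\<close> and \<open>b\<^sub>i\<close>, and \<open>Q = 2 ^ s\<close>,
  what remains is
  \<open>(p\<^sub>1 - p\<^sub>2) X = (p\<^sub>3 - p\<^sub>2) Y\<close> and \<open>(p\<^sub>1 - p\<^sub>2) X ^ Q = (p\<^sub>3 - p\<^sub>2) Y ^ Q\<close> for the differences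
  \<open>X = x\<^sub>1 - x\<^sub>3\<close> and \<open>Y = x\<^sub>2 - x\<^sub>3\<close>; the second equation takes this shape because
  \<open>x \<mapsto> x ^ Q\<close> is additive in characteristic \<open>2\<close>.

  Given one vertex, a neighbour is determined by its first coordinate. Two distinct vertices
  with a common neighbour thus differ in the first coordinate, and in a \<open>6\<close>-cycle any two vertices
  of the same part have a common neighbour. So the coefficients and \<open>X\<close>, \<open>Y\<close> are nonzero, and
  \<open>t = X / Y\<close> satisfies \<open>t ^ (2 ^ s) = t\<close>. All elements of the field satisfy
  \<open>t ^ (2 ^ r) = t\<close>, and \<open>s\<close> and \<open>r\<close> are coprime, so \<open>t\<close> is fixed by the
  Frobenius map itself (\<open>power_power_fixed_gcd\<close>): \<open>t\<^sup>2 = t\<close>. Hence \<open>t = 1\<close>, so \<open>x\<^sub>1 = x\<^sub>2\<close>, a contradiction.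
\<close>

section \<open>Iterated Frobenius maps\<close>

text \<open>
  Multiplication by \<open>x \<noteq> 0\<close> permutes the nonzero elements, so it does not change their
  product.
\<close>

lemma power_card_eq_same:
  fixes x :: "'a::{field,finite}"
  shows "x ^ CARD('a) = x"
proof (cases "x = 0")
  case False
  let ?U = "- {0::'a}"
  have "bij_betw ((*) x) ?U ?U"
    by (rule bij_betw_byWitness[of _ "\<lambda>y. y / x"]) (use False in auto)
  then have "\<Prod>?U = (\<Prod>y\<in>?U. x * y)"
    using prod.reindex_bij_betw[of "(*) x" ?U ?U "\<lambda>y. y"] by simp
  also have "\<dots> = x ^ card ?U * \<Prod>?U"
    by (simp add: prod.distrib)
  finally have "x ^ card ?U = 1"
    by simp
  moreover have "CARD('a) = Suc (card ?U)"
    by (metis Compl_eq_Diff_UNIV UNIV_I card.remove finite)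
  ultimately show ?thesis by simp
qed simp

text \<open>
  If the order \<open>q\<close> is even, then \<open>-1 = (-1) ^ q = 1\<close>.
\<close>

lemma CHAR_eq_2_if_even_card:
  assumes "even CARD('a::{field,finite})"
  shows "CHAR('a) = 2"
proof -
  have "(-1::'a) = 1"
    using power_card_eq_same[of "-1::'a"] assms by simp
  then have "(1::'a) + 1 = 0"
    by (metis add.right_inverse)
  then have "of_nat 2 = (0::'a)"
    by simp
  then have "CHAR('a) dvd 2"
    by (simp only: of_nat_eq_0_iff_char_dvd)
  then show ?thesis
    using CHAR_not_1' two_is_prime_nat by (auto simp: prime_nat_iff)
qed

lemma diff_power_CHAR_power:
  fixes x y :: "'a::comm_ring_1"
  assumes "prime CHAR('a)"
  shows "(x - y) ^ CHAR('a) ^ n = x ^ CHAR('a) ^ n - y ^ CHAR('a) ^ n"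
  using freshmans_dream'[OF assms refl, of "x - y" y n] by simp

lemma power_power_fixed_mult:
  fixes t :: "'a::monoid_mult"
  assumes "t ^ b ^ m = t"
  shows "t ^ b ^ (m * k) = t"
proof (induction k)
  case (Suc k)
  have "t ^ b ^ (m * Suc k) = (t ^ b ^ m) ^ b ^ (m * k)"
    by (simp add: power_add flip: power_mult)
  then show ?case
    using assms Suc.IH by simp
qed simp

text \<open>
  The exponents \<open>n\<close> with \<open>t ^ (b ^ n) = t\<close> are closed under the Euclidean algorithm, by
  Bezout's identity \<open>m x = n y + gcd m n\<close>. For \<open>b = 2\<close> in characteristic \<open>2\<close> this says that the
  fields of order \<open>2 ^ m\<close> and \<open>2 ^ n\<close> intersect in the field of order \<open>2 ^ gcd m n\<close>.
\<close>

lemma power_power_fixed_gcd: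
  fixes t :: "'a::monoid_mult"
  assumes "t ^ b ^ m = t" and "t ^ b ^ n = t" and "m \<noteq> 0"
  shows "t ^ b ^ gcd m n = t"
proof -
  obtain x y where bezout: "m * x = n * y + gcd m n"
    using bezout_nat[OF \<open>m \<noteq> 0\<close>] by blast
  have "t ^ b ^ gcd m n = (t ^ b ^ (n * y)) ^ b ^ gcd m n"
    by (simp add: power_power_fixed_mult assms(2))
  also have "\<dots> = t ^ b ^ (m * x)"
    by (simp add: bezout power_add flip: power_mult)
  also have "\<dots> = t"
    by (simp add: power_power_fixed_mult assms(1))
  finally show ?thesis .
qed

lemma power_two_power_coprime_fixed:
  fixes t :: "'a::{field,finite}"
  assumes "CARD('a) = 2 ^ r" and "coprime s r" and "s \<noteq> 0" and "t ^ 2 ^ s = t"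
  shows "t = 0 \<or> t = 1"
proof -
  have "t ^ 2 ^ r = t"
    using power_card_eq_same[of t] assms(1) by simp
  then have "t ^ 2 ^ gcd s r = t"
    using power_power_fixed_gcd assms(3,4) by blast
  then have "t * t = t"
    using \<open>coprime s r\<close> by (simp add: power2_eq_square)
  then show ?thesis by simp
qed

section \<open>Hexagons in coordinates\<close>

lemma adj_G_left_eqI:
  assumes "adj_G s a b" and "adj_G s a' b" and "fst a = fst a'"
  shows "a = a'"
  using assms by (cases a; cases a'; cases b) (auto, (metis add_left_cancel)+)

lemma adj_G_right_eqI:
  assumes "adj_G s a b" and "adj_G s a b'" and "fst b = fst b'"
  shows "b = b'"
  using assms by (cases a; cases b; cases b') (auto, (metis add_right_cancel)+)

text \<open>
  Both adjacency equations have the form \<open>g + f = p * h\<close>, where \<open>f\<close> and \<open>p\<close> depend only on the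
  left vertex and \<open>g\<close> and \<open>h\<close> only on the right vertex. Going around a hexagon
  with alternating signs, every \<open>f\<close> and every \<open>g\<close> occurs once with each sign.
\<close>

lemma hexagon_alternating_sum:
  fixes p\<^sub>1 p\<^sub>2 p\<^sub>3 :: "'a::comm_ring_1"
  assumes "g\<^sub>1 + f\<^sub>1 = p\<^sub>1 * h\<^sub>1" "g\<^sub>1 + f\<^sub>2 = p\<^sub>2 * h\<^sub>1"
    and "g\<^sub>2 + f\<^sub>2 = p\<^sub>2 * h\<^sub>2" "g\<^sub>2 + f\<^sub>3 = p\<^sub>3 * h\<^sub>2"
    and "g\<^sub>3 + f\<^sub>3 = p\<^sub>3 * h\<^sub>3" "g\<^sub>3 + f\<^sub>1 = p\<^sub>1 * h\<^sub>3"
  shows "(p\<^sub>1 - p\<^sub>2) * (h\<^sub>1 - h\<^sub>3) = (p\<^sub>3 - p\<^sub>2) * (h\<^sub>2 - h\<^sub>3)"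
proof -
  have "(p\<^sub>1 - p\<^sub>2) * (h\<^sub>1 - h\<^sub>3) - (p\<^sub>3 - p\<^sub>2) * (h\<^sub>2 - h\<^sub>3)
    = p\<^sub>1 * h\<^sub>1 - p\<^sub>2 * h\<^sub>1 + p\<^sub>2 * h\<^sub>2 - p\<^sub>3 * h\<^sub>2 + p\<^sub>3 * h\<^sub>3 - p\<^sub>1 * h\<^sub>3"
    by (simp add: algebra_simps)
  also have "\<dots> = 0"
    by (simp flip: assms)
  finally show ?thesis by simp
qed

text \<open>
  Both \<open>X / Y\<close> and \<open>X ^ n / Y ^ n\<close> are equal to \<open>v / u\<close>.
\<close>

lemma ratio_power_fixed:
  fixes u v X Y :: "'a::field"
  assumes "u * X = v * Y" and "u * X ^ n = v * Y ^ n" and "u \<noteq> 0" and "Y \<noteq> 0"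
  shows "(X / Y) ^ n = X / Y"
proof -
  have "X / Y = v / u" and "X ^ n / Y ^ n = v / u"
    using assms by (simp_all add: field_simps)
  then show ?thesis
    by (metis power_divide)
qed

lemma no_hexagon_adj_G:
  fixes a\<^sub>1 a\<^sub>2 a\<^sub>3 b\<^sub>1 b\<^sub>2 b\<^sub>3 :: "'a::{field,finite} \<times> 'a \<times> 'a"
  assumes card: "CARD('a) = 2 ^ r" and "r \<noteq> 0" and "s \<noteq> 0" and "coprime s r"
    and adj: "adj_G s a\<^sub>1 b\<^sub>1" "adj_G s a\<^sub>2 b\<^sub>1" "adj_G s a\<^sub>2 b\<^sub>2"
      "adj_G s a\<^sub>3 b\<^sub>2" "adj_G s a\<^sub>3 b\<^sub>3" "adj_G s a\<^sub>1 b\<^sub>3"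
    and "a\<^sub>1 \<noteq> a\<^sub>2" "b\<^sub>1 \<noteq> b\<^sub>2" "b\<^sub>2 \<noteq> b\<^sub>3" "b\<^sub>1 \<noteq> b\<^sub>3"
  shows False
proof -
  obtain p\<^sub>1 f\<^sub>1 f\<^sub>1' where a1: "a\<^sub>1 = (p\<^sub>1, f\<^sub>1, f\<^sub>1')" by (cases a\<^sub>1)
  obtain p\<^sub>2 f\<^sub>2 f\<^sub>2' where a2: "a\<^sub>2 = (p\<^sub>2, f\<^sub>2, f\<^sub>2')" by (cases a\<^sub>2)
  obtain p\<^sub>3 f\<^sub>3 f\<^sub>3' where a3: "a\<^sub>3 = (p\<^sub>3, f\<^sub>3, f\<^sub>3')" by (cases a\<^sub>3)
  obtain x\<^sub>1 g\<^sub>1 g\<^sub>1' where b1: "b\<^sub>1 = (x\<^sub>1, g\<^sub>1, g\<^sub>1')" by (cases b\<^sub>1)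
  obtain x\<^sub>2 g\<^sub>2 g\<^sub>2' where b2: "b\<^sub>2 = (x\<^sub>2, g\<^sub>2, g\<^sub>2')" by (cases b\<^sub>2)
  obtain x\<^sub>3 g\<^sub>3 g\<^sub>3' where b3: "b\<^sub>3 = (x\<^sub>3, g\<^sub>3, g\<^sub>3')" by (cases b\<^sub>3)
  note coords = a1 a2 a3 b1 b2 b3
  have "p\<^sub>1 \<noteq> p\<^sub>2"
    using adj_G_left_eqI[OF adj(1,2)] \<open>a\<^sub>1 \<noteq> a\<^sub>2\<close> coords by auto
  have "x\<^sub>1 \<noteq> x\<^sub>2"
    using adj_G_right_eqI[OF adj(2,3)] \<open>b\<^sub>1 \<noteq> b\<^sub>2\<close> coords by auto
  have "x\<^sub>2 \<noteq> x\<^sub>3"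
    using adj_G_right_eqI[OF adj(4,5)] \<open>b\<^sub>2 \<noteq> b\<^sub>3\<close> coords by auto
  have "x\<^sub>1 \<noteq> x\<^sub>3"
    using adj_G_right_eqI[OF adj(6,1)] \<open>b\<^sub>1 \<noteq> b\<^sub>3\<close> coords by auto
  have char: "CHAR('a) = 2"
    by (rule CHAR_eq_2_if_even_card) (use card \<open>r \<noteq> 0\<close> in simp)
  have diff_power: "(x - y) ^ 2 ^ s = x ^ 2 ^ s - y ^ 2 ^ s" for x y :: 'a
    using diff_power_CHAR_power[of x y s] by (simp add: char)
  have "(p\<^sub>1 - p\<^sub>2) * (x\<^sub>1 - x\<^sub>3) = (p\<^sub>3 - p\<^sub>2) * (x\<^sub>2 - x\<^sub>3)"
    by (rule hexagon_alternating_sum[of g\<^sub>1 f\<^sub>1 _ _ f\<^sub>2 _ g\<^sub>2 _ f\<^sub>3 _ g\<^sub>3])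
      (use adj coords in auto)
  moreover have "(p\<^sub>1 - p\<^sub>2) * (x\<^sub>1 - x\<^sub>3) ^ 2 ^ s = (p\<^sub>3 - p\<^sub>2) * (x\<^sub>2 - x\<^sub>3) ^ 2 ^ s"
    unfolding diff_power
    by (rule hexagon_alternating_sum[of g\<^sub>1' f\<^sub>1' _ _ f\<^sub>2' _ g\<^sub>2' _ f\<^sub>3' _ g\<^sub>3'])
      (use adj coords in auto)
  ultimately have "((x\<^sub>1 - x\<^sub>3) / (x\<^sub>2 - x\<^sub>3)) ^ 2 ^ s = (x\<^sub>1 - x\<^sub>3) / (x\<^sub>2 - x\<^sub>3)"
    by (rule ratio_power_fixed) (use \<open>p\<^sub>1 \<noteq> p\<^sub>2\<close> \<open>x\<^sub>2 \<noteq> x\<^sub>3\<close> in auto)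
  then have "(x\<^sub>1 - x\<^sub>3) / (x\<^sub>2 - x\<^sub>3) = 0 \<or> (x\<^sub>1 - x\<^sub>3) / (x\<^sub>2 - x\<^sub>3) = 1"
    using power_two_power_coprime_fixed card \<open>coprime s r\<close> \<open>s \<noteq> 0\<close> by blast
  then show False
    using \<open>x\<^sub>1 \<noteq> x\<^sub>2\<close> \<open>x\<^sub>2 \<noteq> x\<^sub>3\<close> \<open>x\<^sub>1 \<noteq> x\<^sub>3\<close> by simp
qed

section \<open>Cycles of length six\<close>

lemma cycle_length_6E:
  assumes "pre_digraph.cycle (with_proj G) p" and "length p = 6"
  obtains v\<^sub>1 v\<^sub>2 v\<^sub>3 v\<^sub>4 v\<^sub>5 v\<^sub>6
  where "distinct [v\<^sub>1, v\<^sub>2, v\<^sub>3, v\<^sub>4, v\<^sub>5, v\<^sub>6]"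
    and "{(v\<^sub>1, v\<^sub>2), (v\<^sub>2, v\<^sub>3), (v\<^sub>3, v\<^sub>4), (v\<^sub>4, v\<^sub>5), (v\<^sub>5, v\<^sub>6), (v\<^sub>6, v\<^sub>1)} \<subseteq> parcs G"
proof -
  obtain e\<^sub>1 e\<^sub>2 e\<^sub>3 e\<^sub>4 e\<^sub>5 e\<^sub>6 where p: "p = [e\<^sub>1, e\<^sub>2, e\<^sub>3, e\<^sub>4, e\<^sub>5, e\<^sub>6]"
    using assms(2) by (auto simp: numeral_eq_Suc length_Suc_conv)
  obtain u where awalk: "pre_digraph.awalk (with_proj G) u p u"
    and tl_distinct: "distinct (tl (pre_digraph.awalk_verts (with_proj G) u p))"
    using assms(1) unfolding pre_digraph.cycle_def by blast
  have links: "snd e\<^sub>1 = fst e\<^sub>2" "snd e\<^sub>2 = fst e\<^sub>3" "snd e\<^sub>3 = fst e\<^sub>4" "snd e\<^sub>4 = fst e\<^sub>5"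
    "snd e\<^sub>5 = fst e\<^sub>6" "snd e\<^sub>6 = fst e\<^sub>1" and mem: "set p \<subseteq> parcs G"
    using awalk unfolding p pre_digraph.awalk_def by (simp_all add: pre_digraph.cas.simps)
  \<comment> \<open>The vertex list of a closed walk starts and ends with the same vertex; its tail is the
    vertex sequence rotated by one step.\<close>
  have "distinct [fst e\<^sub>2, fst e\<^sub>3, fst e\<^sub>4, fst e\<^sub>5, fst e\<^sub>6, fst e\<^sub>1]"
    using tl_distinct unfolding p by (simp add: pre_digraph.awalk_verts.simps links)
  then have "distinct [fst e\<^sub>1, fst e\<^sub>2, fst e\<^sub>3, fst e\<^sub>4, fst e\<^sub>5, fst e\<^sub>6]"
    by auto
  moreover have "(fst e\<^sub>1, fst e\<^sub>2) = e\<^sub>1" "(fst e\<^sub>2, fst e\<^sub>3) = e\<^sub>2" "(fst e\<^sub>3, fst e\<^sub>4) = e\<^sub>3"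
    "(fst e\<^sub>4, fst e\<^sub>5) = e\<^sub>4" "(fst e\<^sub>5, fst e\<^sub>6) = e\<^sub>5" "(fst e\<^sub>6, fst e\<^sub>1) = e\<^sub>6"
    by (simp_all add: prod_eq_iff links)
  then have "{(fst e\<^sub>1, fst e\<^sub>2), (fst e\<^sub>2, fst e\<^sub>3), (fst e\<^sub>3, fst e\<^sub>4), (fst e\<^sub>4, fst e\<^sub>5),
      (fst e\<^sub>5, fst e\<^sub>6), (fst e\<^sub>6, fst e\<^sub>1)} \<subseteq> parcs G"
    using mem by (simp add: p)
  ultimately show thesis by (rule that)
qed

theorem theorem1p5:
  fixes r s :: nat
  assumes "r \<ge> 1"
    and "CARD('a::{field,finite}) = 2 ^ r"
    and "1 \<le> s" and "s \<le> r"
    and "gcd s r = 1"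
  shows "C6_free (graph_G s ::
    (('a \<times> 'a \<times> 'a) + ('a \<times> 'a \<times> 'a)) pair_pre_digraph)"
  unfolding C6_free_def
proof (intro notI, elim exE conjE)
  let ?G = "graph_G s :: (('a \<times> 'a \<times> 'a) + ('a \<times> 'a \<times> 'a)) pair_pre_digraph"
  fix p
  assume "pre_digraph.cycle (with_proj ?G) p" and "length p = 6"
  then obtain v\<^sub>1 v\<^sub>2 v\<^sub>3 v\<^sub>4 v\<^sub>5 v\<^sub>6
    where distinct: "distinct [v\<^sub>1, v\<^sub>2, v\<^sub>3, v\<^sub>4, v\<^sub>5, v\<^sub>6]"
      and arcs: "{(v\<^sub>1, v\<^sub>2), (v\<^sub>2, v\<^sub>3), (v\<^sub>3, v\<^sub>4), (v\<^sub>4, v\<^sub>5), (v\<^sub>5, v\<^sub>6), (v\<^sub>6, v\<^sub>1)} \<subseteq> parcs ?G"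
    by (rule cycle_length_6E)
  have "r \<noteq> 0" and "s \<noteq> 0" and "coprime s r"
    using assms by (auto simp: coprime_iff_gcd_eq_1)
  note no_hexagon = no_hexagon_adj_G[OF assms(2) this]
  show False
  proof (cases v\<^sub>1)
    case (Inl a\<^sub>1)
    with arcs obtain b\<^sub>1 a\<^sub>2 b\<^sub>2 a\<^sub>3 b\<^sub>3 where
      "v\<^sub>2 = Inr b\<^sub>1" "v\<^sub>3 = Inl a\<^sub>2" "v\<^sub>4 = Inr b\<^sub>2" "v\<^sub>5 = Inl a\<^sub>3" "v\<^sub>6 = Inr b\<^sub>3"
      by (cases v\<^sub>2; cases v\<^sub>3; cases v\<^sub>4; cases v\<^sub>5; cases v\<^sub>6) (auto simp: graph_G_arc_iff)
    with Inl show False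
      using no_hexagon[of a\<^sub>1 b\<^sub>1 a\<^sub>2 b\<^sub>2 a\<^sub>3 b\<^sub>3] distinct arcs by (auto simp: graph_G_arc_iff)
  next
    \<comment> \<open>Read the cycle from \<open>v\<^sub>2\<close> onwards to start on the left side.\<close>
    case (Inr b\<^sub>3)
    with arcs obtain a\<^sub>1 b\<^sub>1 a\<^sub>2 b\<^sub>2 a\<^sub>3 where
      "v\<^sub>2 = Inl a\<^sub>1" "v\<^sub>3 = Inr b\<^sub>1" "v\<^sub>4 = Inl a\<^sub>2" "v\<^sub>5 = Inr b\<^sub>2" "v\<^sub>6 = Inl a\<^sub>3"
      by (cases v\<^sub>2; cases v\<^sub>3; cases v\<^sub>4; cases v\<^sub>5; cases v\<^sub>6) (auto simp: graph_G_arc_iff)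
    with Inr show False
      using no_hexagon[of a\<^sub>1 b\<^sub>1 a\<^sub>2 b\<^sub>2 a\<^sub>3 b\<^sub>3] distinct arcs by (auto simp: graph_G_arc_iff)
  qed
qed

end
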